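(* Let $n\ge 1$, let $J\subseteq[n-1]$, and let $J^b=(a_1,a_2,\dots,a_k)$ be the sequence of block sizes of $J$. Then the number $M(a_1,\dots,a_k)=M_J$ of permutations $\sigma\in\mathfrak{S}_n$ with descent set $J$ and exactly $n-|J|$ fixed points is the coefficient of $x_1^{a_1}x_2^{a_2}\cdots x_k^{a_k}$ in the power series expansion of $$\frac{1}{(1+x_1)(1+x_2)\cdots(1+x_k)(1-x_1-x_2-\cdots-x_k)}.$$
   Context: $[n]=\{1,\dots,n\}$; $\mathfrak{S}_n$ is the set of permutations $\sigma=\sigma_1\cdots\sigma_n$ of $[n]$; the descent set of $\sigma$ is $\{i:1\le i\le n-1,\ \sigma_i>\sigma_{i+1}\}$; a fixed point is an index $i$ with $\sigma_i=i$. Every $J\subseteq[n-1]$ is partitioned into its maximal blocks of consecutive integers (numbers from different blocks differ by at least $2$); $J^b=(a_1,\dots,a_k)$ is the sequence of sizes of these blocks, in increasing order of position. For instance $J=\{1,2,3,6\}$ has $J^b=(3,1)$. (If $J=\emptyset$ then $k=0$ and the fraction is $1$.) $M_J$ is the number of permutations in $\mathfrak{S}_n$ with descent set $J$ having $n-|J|$ fixed points; it depends only on $J^b$ and is denoted $M(a_1,\dots,a_k)$. *)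

theory Defs
  imports
    Complex_Main
    "HOL-Combinatorics.Permutations"
    "HOL-Library.Poly_Mapping"
begin

definition descent_set :: "nat \<Rightarrow> (nat \<Rightarrow> nat) \<Rightarrow> nat set" where
  "descent_set n \<sigma> = {i. 1 \<le> i \<and> i \<le> n - 1 \<and> \<sigma> i > \<sigma> (i + 1)}"

definition fixed_points :: "nat \<Rightarrow> (nat \<Rightarrow> nat) \<Rightarrow> nat set" where
  "fixed_points n \<sigma> = {i \<in> {1..n}. \<sigma> i = i}"

definition M_perms :: "nat \<Rightarrow> nat set \<Rightarrow> (nat \<Rightarrow> nat) set" where
  "M_perms n J = {\<sigma>. \<sigma> permutes {1..n} \<and> descent_set n \<sigma> = J \<and>
                      card (fixed_points n \<sigma>) = n - card J}"

definition runs :: "nat set \<Rightarrow> nat set set" where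
  "runs J = {{a..b} | a b. a \<le> b \<and> {a..b} \<subseteq> J}"

definition blocks :: "nat set \<Rightarrow> nat set set" where
  "blocks J = {B \<in> runs J. \<forall>C \<in> runs J. B \<subseteq> C \<longrightarrow> C = B}"

definition block_list :: "nat set \<Rightarrow> nat set list" where
  "block_list J = (THE Bs. set Bs = blocks J \<and> sorted_wrt (\<lambda>B C. Min B < Min C) Bs)"

definition block_sizes :: "nat set \<Rightarrow> nat list" where
  "block_sizes J = map card (block_list J)"

lemma inj_on_Min_blocks: "inj_on Min (blocks J)"
proof (rule inj_onI)
  fix B C assume BC: "B \<in> blocks J" "C \<in> blocks J" and eq: "Min B = Min C"
  obtain a b where B: "B = {a..b}" "a \<le> b"
    using BC(1) by (auto simp: blocks_def runs_def)
  obtain c d where C: "C = {c..d}" "c \<le> d"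
    using BC(2) by (auto simp: blocks_def runs_def)
  have "Min B = a" "Min C = c"
    using B C by (auto intro!: Min_eqI)
  with eq B C have "B \<subseteq> C \<or> C \<subseteq> B"
    by auto
  then show "B = C"
    using BC by (auto simp: blocks_def)
qed

lemma block_list_unique:
  assumes "set Bs = blocks J" "sorted_wrt (\<lambda>B C. Min B < Min C) Bs"
  shows "block_list J = Bs"
  unfolding block_list_def
proof (rule the_equality)
  show "set Bs = blocks J \<and> sorted_wrt (\<lambda>B C. Min B < Min C) Bs"
    using assms by simp
next
  fix Cs assume Cs: "set Cs = blocks J \<and> sorted_wrt (\<lambda>B C. Min B < Min C) Cs"
  have "map Min Cs = map Min Bs"
    by (rule strict_sorted_equal) (use assms Cs in \<open>auto simp: sorted_wrt_map\<close>)
  then show "Cs = Bs"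
    by (rule map_inj_on) (use assms Cs inj_on_Min_blocks in auto)
qed

lemma block_list:
  assumes "finite J"
  shows "set (block_list J) = blocks J" "sorted_wrt (\<lambda>B C. Min B < Min C) (block_list J)"
proof -
  have "finite (blocks J)"
    by (rule finite_subset[of _ "Pow J"]) (auto simp: blocks_def runs_def assms)
  define Bs where "Bs = map (inv_into (blocks J) Min) (sorted_list_of_set (Min ` blocks J))"
  have "map Min Bs = sorted_list_of_set (Min ` blocks J)"
    unfolding Bs_def map_map
    by (rule map_idI) (use \<open>finite (blocks J)\<close> in \<open>auto simp: f_inv_into_f\<close>)
  then have "sorted_wrt (<) (map Min Bs)"
    by simp
  then have 1: "sorted_wrt (\<lambda>B C. Min B < Min C) Bs"
    by (simp only: sorted_wrt_map)
  have 2: "set Bs = blocks J"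
    using \<open>finite (blocks J)\<close> inj_on_Min_blocks[of J]
    by (simp add: Bs_def image_image inv_into_f_f)
  show "set (block_list J) = blocks J" "sorted_wrt (\<lambda>B C. Min B < Min C) (block_list J)"
    using 1 2 block_list_unique[OF 2 1] by simp_all
qed

text \<open>Formal power series in variables indexed by \<^typ>\<open>nat\<close>: a monomial is its exponent vector,
  of type \<^typ>\<open>nat \<Rightarrow>\<^sub>0 nat\<close>, and a series is an arbitrary coefficient function on monomials.
  The variables that actually occur in a series are not fixed by the type.\<close>

typedef 'a mfps = "UNIV :: ((nat \<Rightarrow>\<^sub>0 nat) \<Rightarrow> 'a) set"
  morphisms mcoeff Abs_mfps
  by simp

setup_lifting type_definition_mfps

lemma mfps_eq_iff: "f = g \<longleftrightarrow> (\<forall>m. mcoeff f m = mcoeff g m)"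
  by transfer auto

lemma mfps_eqI: "(\<And>m. mcoeff f m = mcoeff g m) \<Longrightarrow> f = g"
  by (simp add: mfps_eq_iff)

definition splits :: "(nat \<Rightarrow>\<^sub>0 nat) \<Rightarrow> ((nat \<Rightarrow>\<^sub>0 nat) \<times> (nat \<Rightarrow>\<^sub>0 nat)) set" where
  "splits m = {(p, q). p + q = m}"

lemma finite_splits [simp]: "finite (splits m)"
proof -
  define S where "S = {f :: nat \<Rightarrow> nat. \<forall>x. (x \<in> Poly_Mapping.keys m \<longrightarrow>
      f x \<in> {..Max (Poly_Mapping.lookup m ` Poly_Mapping.keys m)}) \<and>
      (x \<notin> Poly_Mapping.keys m \<longrightarrow> f x = 0)}"
  have "finite S"
    unfolding S_def by (rule finite_set_of_finite_funs) auto
  have *: "Poly_Mapping.lookup p \<in> S" if "p + q = m" for p q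
  proof -
    have le: "Poly_Mapping.lookup p x \<le> Poly_Mapping.lookup m x" for x
      using that by (auto simp: Poly_Mapping.lookup_add)
    have "Poly_Mapping.lookup p x \<le> Max (Poly_Mapping.lookup m ` Poly_Mapping.keys m)"
      if "x \<in> Poly_Mapping.keys m" for x
      using le[of x] that by (meson Max_ge finite_imageI finite_keys image_eqI order_trans)
    moreover have "Poly_Mapping.lookup p x = 0" if "x \<notin> Poly_Mapping.keys m" for x
      using le[of x] that by (simp add: Poly_Mapping.in_keys_iff)
    ultimately show ?thesis
      by (simp add: S_def)
  qed
  define P where "P = {p. Poly_Mapping.lookup p \<in> S}"
  have "Poly_Mapping.lookup ` P \<subseteq> S"
    by (auto simp: P_def)
  moreover have "inj_on Poly_Mapping.lookup P"
    by (simp add: inj_on_def Poly_Mapping.lookup_inject)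
  ultimately have "finite P"
    using \<open>finite S\<close> by (meson finite_imageD finite_subset)
  moreover have "splits m \<subseteq> P \<times> P"
  proof
    fix u assume "u \<in> splits m"
    then have "fst u + snd u = m" "snd u + fst u = m"
      by (auto simp: splits_def add.commute)
    then show "u \<in> P \<times> P"
      using *[of "fst u" "snd u"] *[of "snd u" "fst u"] by (simp add: P_def mem_Times_iff)
  qed
  ultimately show ?thesis
    by (meson finite_SigmaI finite_subset)
qed

instantiation mfps :: (comm_ring_1) comm_ring_1
begin

lift_definition zero_mfps :: "'a mfps" is "\<lambda>_. 0" .
lift_definition one_mfps :: "'a mfps" is "\<lambda>m. if m = 0 then 1 else 0" .
lift_definition plus_mfps :: "'a mfps \<Rightarrow> 'a mfps \<Rightarrow> 'a mfps" is "\<lambda>f g m. f m + g m" .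
lift_definition minus_mfps :: "'a mfps \<Rightarrow> 'a mfps \<Rightarrow> 'a mfps" is "\<lambda>f g m. f m - g m" .
lift_definition uminus_mfps :: "'a mfps \<Rightarrow> 'a mfps" is "\<lambda>f m. - f m" .
lift_definition times_mfps :: "'a mfps \<Rightarrow> 'a mfps \<Rightarrow> 'a mfps" is
  "\<lambda>f g m. \<Sum>(p, q) \<in> splits m. f p * g q" .

instance
proof
  fix f g h :: "'a mfps"
  show "f * g * h = f * (g * h)"
  proof (rule mfps_eqI)
    fix m
    have "mcoeff (f * g * h) m =
        (\<Sum>(r, s) \<in> splits m. \<Sum>(p, q) \<in> splits r. mcoeff f p * mcoeff g q * mcoeff h s)"
      by (simp add: times_mfps.rep_eq sum_distrib_right split_beta)
    also have "\<dots> = (\<Sum>((r, s), (p, q)) \<in> (SIGMA u : splits m. splits (fst u)).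
                       mcoeff f p * mcoeff g q * mcoeff h s)"
      unfolding split_beta by (subst sum.Sigma) (auto simp: split_beta)
    also have "\<dots> = (\<Sum>((p, t), (q, s)) \<in> (SIGMA u : splits m. splits (snd u)).
                       mcoeff f p * (mcoeff g q * mcoeff h s))"
      by (rule sum.reindex_bij_witness[of _
            "\<lambda>((p, t), (q, s)). ((p + q, s), (p, q))"
            "\<lambda>((r, s), (p, q)). ((p, q + s), (q, s))"])
         (auto simp: splits_def add.assoc mult.assoc)
    also have "\<dots> = (\<Sum>(p, t) \<in> splits m. \<Sum>(q, s) \<in> splits t.
                       mcoeff f p * (mcoeff g q * mcoeff h s))"
      unfolding split_beta by (subst sum.Sigma) (auto simp: split_beta)
    also have "\<dots> = mcoeff (f * (g * h)) m"
      by (simp add: times_mfps.rep_eq sum_distrib_left split_beta)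
    finally show "mcoeff (f * g * h) m = mcoeff (f * (g * h)) m" .
  qed
  show "f * g = g * f"
  proof (rule mfps_eqI)
    fix m
    show "mcoeff (f * g) m = mcoeff (g * f) m"
      unfolding times_mfps.rep_eq
      by (rule sum.reindex_bij_witness[of _ prod.swap prod.swap])
         (auto simp: splits_def ac_simps)
  qed
  show "1 * f = f"
  proof (rule mfps_eqI)
    fix m
    have "mcoeff (1 * f) m = (\<Sum>u \<in> {(0, m)}. mcoeff 1 (fst u) * mcoeff f (snd u))"
      unfolding times_mfps.rep_eq split_beta
      by (rule sum.mono_neutral_right, rule finite_splits)
         (auto simp: splits_def one_mfps.rep_eq)
    then show "mcoeff (1 * f) m = mcoeff f m"
      by (simp add: one_mfps.rep_eq)
  qed
  show "(f + g) * h = f * h + g * h"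
    by (rule mfps_eqI)
       (simp add: times_mfps.rep_eq plus_mfps.rep_eq distrib_right sum.distrib split_beta)
  show "f + g + h = f + (g + h)" "f + g = g + f" "0 + f = f" "- f + f = 0" "f - g = f + - g"
    by (simp_all add: mfps_eq_iff plus_mfps.rep_eq zero_mfps.rep_eq uminus_mfps.rep_eq
          minus_mfps.rep_eq add.assoc add.commute)
  show "(0 :: 'a mfps) \<noteq> 1"
    by (auto simp: mfps_eq_iff zero_mfps.rep_eq one_mfps.rep_eq)
qed

end

lift_definition mX :: "nat \<Rightarrow> 'a :: comm_ring_1 mfps" is
  "\<lambda>i m. if m = Poly_Mapping.single i 1 then 1 else 0" .

text \<open>As usual for total division, the inverse of a series that is not a unit is \<open>0\<close>.
  The series inverted in the main statement are units: see \<open>mfps_denominator_unit\<close> below.\<close>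

instantiation mfps :: (comm_ring_1) inverse
begin

definition inverse_mfps :: "'a mfps \<Rightarrow> 'a mfps" where
  "inverse (f :: 'a mfps) = (if f dvd 1 then THE g. f * g = 1 else 0)"

definition divide_mfps :: "'a mfps \<Rightarrow> 'a mfps \<Rightarrow> 'a mfps" where
  "(f :: 'a mfps) div g = f * inverse g"

instance ..

end

lemma mfps_inverse_unique:
  fixes f g :: "'a :: comm_ring_1 mfps"
  assumes "f * g = 1"
  shows "inverse f = g"
proof -
  have "f dvd 1"
    using assms by (metis dvd_triv_left)
  moreover have "(THE g. f * g = 1) = g"
  proof (rule the_equality)
    fix h assume "f * h = 1"
    then have "g * (f * h) = g"
      by simp
    then show "h = g"
      using assms by (metis mult.assoc mult.commute mult_1)
  qed (fact assms)
  ultimately show ?thesis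
    by (simp add: inverse_mfps_def)
qed

lemma mfps_mult_inverse:
  fixes f :: "'a :: comm_ring_1 mfps"
  assumes "f dvd 1"
  shows "f * inverse f = 1"
  using assms mfps_inverse_unique by (metis dvdE)

definition mdeg :: "(nat \<Rightarrow>\<^sub>0 nat) \<Rightarrow> nat" where
  "mdeg m = (\<Sum>i \<in> Poly_Mapping.keys m. Poly_Mapping.lookup m i)"

lemma mdeg_superset:
  assumes "finite A" "Poly_Mapping.keys m \<subseteq> A"
  shows "mdeg m = (\<Sum>i \<in> A. Poly_Mapping.lookup m i)"
  unfolding mdeg_def
  by (rule sum.mono_neutral_left) (use assms in \<open>auto simp: Poly_Mapping.in_keys_iff\<close>)

lemma mdeg_add: "mdeg (p + q) = mdeg p + mdeg q"
proof -
  let ?A = "Poly_Mapping.keys p \<union> Poly_Mapping.keys q"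
  have "mdeg (p + q) = (\<Sum>i \<in> ?A. Poly_Mapping.lookup (p + q) i)"
    by (rule mdeg_superset) (simp_all add: Poly_Mapping.keys_add)
  also have "\<dots> = (\<Sum>i \<in> ?A. Poly_Mapping.lookup p i) + (\<Sum>i \<in> ?A. Poly_Mapping.lookup q i)"
    by (simp add: Poly_Mapping.lookup_add sum.distrib)
  also have "\<dots> = mdeg p + mdeg q"
    by (simp add: mdeg_superset[of ?A p] mdeg_superset[of ?A q])
  finally show ?thesis .
qed

lemma mdeg_eq_0_iff: "mdeg m = 0 \<longleftrightarrow> m = 0"
  by (auto simp: mdeg_def Poly_Mapping.in_keys_iff intro!: poly_mapping_eqI)

lemma mcoeff_power_eq_0:
  fixes e :: "'a :: comm_ring_1 mfps"
  assumes "mcoeff e 0 = 0" "mdeg m < n"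
  shows "mcoeff (e ^ n) m = 0"
  using assms(2)
proof (induction n arbitrary: m)
  case (Suc n)
  have "mcoeff e p * mcoeff (e ^ n) q = 0" if "p + q = m" for p q
  proof (cases "p = 0")
    case False
    then have "mdeg q < n"
      using Suc.prems that mdeg_add[of p q] mdeg_eq_0_iff[of p] by auto
    then show ?thesis
      using Suc.IH by simp
  qed (use assms(1) in simp)
  then show ?case
    by (auto simp: times_mfps.rep_eq splits_def intro!: sum.neutral)
qed simp

lemma mfps_unit_const_coeff_1:
  fixes f :: "'a :: comm_ring_1 mfps"
  assumes "mcoeff f 0 = 1"
  shows "f dvd 1"
proof -
  define e where "e = 1 - f"
  have e0: "mcoeff e 0 = 0"
    using assms by (simp add: e_def minus_mfps.rep_eq one_mfps.rep_eq)
  define s where "s N = (\<Sum>n < N. e ^ n)" for N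
  define g where "g = Abs_mfps (\<lambda>m. mcoeff (s (Suc (mdeg m))) m)"
  have s_stable: "mcoeff (s (Suc N)) m = mcoeff (s (Suc (mdeg m))) m" if "mdeg m \<le> N" for N m
    using that
  proof (induction N rule: dec_induct)
    case (step N)
    then have "mcoeff (e ^ Suc N) m = 0"
      by (intro mcoeff_power_eq_0 e0) simp
    with step show ?case
      by (simp add: s_def plus_mfps.rep_eq)
  qed simp
  have g: "mcoeff g m = mcoeff (s (Suc N)) m" if "mdeg m \<le> N" for N m
    using s_stable[OF that] by (simp add: g_def Abs_mfps_inverse)
  have "f * g = 1"
  proof (rule mfps_eqI)
    fix m
    have "mcoeff (f * g) m = mcoeff (f * s (Suc (mdeg m))) m"
      unfolding times_mfps.rep_eq
      by (intro sum.cong refl) (auto simp: splits_def mdeg_add intro!: arg_cong[where f = "(*) _"] g)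
    also have "f * s (Suc (mdeg m)) = 1 - e ^ Suc (mdeg m)"
      unfolding s_def using one_diff_power_eq[of e "Suc (mdeg m)"] by (simp add: e_def)
    also have "mcoeff \<dots> m = mcoeff 1 m"
      using mcoeff_power_eq_0[OF e0, of m "Suc (mdeg m)"] by (simp add: minus_mfps.rep_eq)
    finally show "mcoeff (f * g) m = mcoeff 1 m" .
  qed
  then show ?thesis
    by (metis dvd_triv_left)
qed

lemma mcoeff_mult_0:
  fixes f g :: "'a :: comm_ring_1 mfps"
  shows "mcoeff (f * g) 0 = mcoeff f 0 * mcoeff g 0"
proof -
  have "u = (0, 0)" if "u \<in> splits 0" for u
  proof -
    have "mdeg (fst u) + mdeg (snd u) = mdeg 0"
      using that unfolding splits_def mdeg_add[symmetric] by force
    then have "mdeg (fst u) = 0" "mdeg (snd u) = 0"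
      by (simp_all add: mdeg_def)
    then show ?thesis
      by (simp add: mdeg_eq_0_iff prod_eq_iff)
  qed
  moreover have "(0, 0) \<in> splits 0"
    by (simp add: splits_def)
  ultimately have "splits 0 = {(0, 0)}"
    by blast
  moreover have "mcoeff (f * g) 0 = (\<Sum>(p, q) \<in> splits 0. mcoeff f p * mcoeff g q)"
    by (simp only: times_mfps.rep_eq)
  ultimately show ?thesis
    by (simp only: sum.insert sum.empty finite.emptyI empty_iff) simp
qed

lemma mfps_denominator_unit:
  "(\<Prod>i<k. 1 + mX i) * (1 - (\<Sum>i<k. mX i)) dvd (1 :: 'a :: comm_ring_1 mfps)"
proof (rule mfps_unit_const_coeff_1)
  have "Poly_Mapping.single i (1 :: nat) \<noteq> 0" for i :: nat
    by (metis lookup_single_eq lookup_zero one_neq_zero)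
  then have X0: "mcoeff (mX i :: 'a mfps) 0 = 0" for i
    by (metis mX.rep_eq)
  have "mcoeff (\<Prod>i<k. 1 + mX i :: 'a mfps) 0 = 1"
    by (induction k) (simp_all add: mcoeff_mult_0 plus_mfps.rep_eq one_mfps.rep_eq X0)
  moreover have "mcoeff (\<Sum>i<k. mX i :: 'a mfps) 0 = 0"
    by (induction k) (simp_all add: plus_mfps.rep_eq zero_mfps.rep_eq X0)
  ultimately show "mcoeff ((\<Prod>i<k. 1 + mX i) * (1 - (\<Sum>i<k. mX i)) :: 'a mfps) 0 = 1"
    by (simp add: mcoeff_mult_0 minus_mfps.rep_eq one_mfps.rep_eq)
qed

end

theory Submission
  imports Defs
begin

text \<open>A decreasing sequence has at most one fixed point, so a permutation with descent set \<open>J\<close> has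
  \<open>n - |J|\<close> fixed points exactly when each of its \<open>n - |J|\<close> maximal decreasing runs contains one.
  Conversely, if each prescribed decreasing segment contains a fixed point, then the ascents between
  consecutive segments are automatic. Deleting a fixed point of a segment is invertible: there is
  exactly one place where a fixed point can be inserted into a decreasing segment without one,
  namely between its excedances and its anti-excedances. Hence \<open>M\<^sub>J\<close> counts derangements which are
  decreasing on segments of sizes \<open>a\<^sub>1, \<dots>, a\<^sub>k\<close>. Dropping the derangement condition, one gets the
  multinomial coefficients, with series \<open>1 / (1 - x\<^sub>1 - \<dots> - x\<^sub>k)\<close>; forbidding fixed points in segment
  \<open>i\<close> divides the series by \<open>1 + x\<^sub>i\<close>, by the same deletion.\<close>

section \<open>Inserting and deleting one entry of a permutation\<close>

text \<open>This is the coface map, the increasing enumeration of the naturals other than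
  \<open>p\<close>; \<open>unskip p\<close> is the codegeneracy undoing it. Together they renumber
  both positions and values around an entry that is added or removed.\<close>

definition skip :: "nat \<Rightarrow> nat \<Rightarrow> nat" where
  "skip p j = (if j < p then j else Suc j)"

definition unskip :: "nat \<Rightarrow> nat \<Rightarrow> nat" where
  "unskip p j = (if j < p then j else j - 1)"

text \<open>In matrix terms, a new row \<open>p\<close> and a new column \<open>v\<close>, meeting
  in a 1, are added to the permutation matrix of \<open>\<tau>\<close>.\<close>

definition insert_at :: "nat \<Rightarrow> nat \<Rightarrow> (nat \<Rightarrow> nat) \<Rightarrow> nat \<Rightarrow> nat" where
  "insert_at p v \<tau> j = (if j = p then v else skip v (\<tau> (unskip p j)))"

definition delete_at :: "nat \<Rightarrow> nat \<Rightarrow> (nat \<Rightarrow> nat) \<Rightarrow> nat \<Rightarrow> nat" where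
  "delete_at p v \<sigma> j = unskip v (\<sigma> (skip p j))"

lemma unskip_skip [simp]: "unskip p (skip p j) = j"
  by (simp add: skip_def unskip_def)

lemma skip_unskip [simp]: "j \<noteq> p \<Longrightarrow> skip p (unskip p j) = j"
  by (auto simp: skip_def unskip_def)

lemma skip_neq [simp]: "skip p j \<noteq> p" "p \<noteq> skip p j"
  by (auto simp: skip_def)

lemma skip_less_iff [simp]: "skip p i < skip p j \<longleftrightarrow> i < j"
  by (auto simp: skip_def)

lemma skip_eq_iff [simp]: "skip p i = skip p j \<longleftrightarrow> i = j"
  by (auto simp: skip_def)

lemma insert_at_same [simp]: "insert_at p v \<tau> p = v"
  by (simp add: insert_at_def)

lemma insert_at_skip [simp]: "insert_at p v \<tau> (skip p j) = skip v (\<tau> j)"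
  by (simp add: insert_at_def)

lemma delete_insert_at [simp]: "delete_at p v (insert_at p v \<tau>) = \<tau>"
  by (rule ext) (simp add: delete_at_def)

lemma insert_delete_at:
  assumes "inj \<sigma>" "\<sigma> p = v"
  shows "insert_at p v (delete_at p v \<sigma>) = \<sigma>"
proof
  fix j
  show "insert_at p v (delete_at p v \<sigma>) j = \<sigma> j"
  proof (cases "j = p")
    case False
    then have "\<sigma> j \<noteq> v" using assms by (metis injD)
    then show ?thesis using False by (simp add: insert_at_def delete_at_def)
  qed (simp add: assms)
qed

lemma skip_range: "p \<in> {1..Suc n} \<Longrightarrow> j \<in> {1..n} \<Longrightarrow> skip p j \<in> {1..Suc n}"
  by (auto simp: skip_def)

lemma range_Suc_skip:
  assumes "p \<in> {1..Suc n}"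
  shows "{1..Suc n} = insert p (skip p ` {1..n})"
proof
  show "{1..Suc n} \<subseteq> insert p (skip p ` {1..n})"
  proof
    fix j assume j: "j \<in> {1..Suc n}"
    show "j \<in> insert p (skip p ` {1..n})"
    proof (cases "j = p")
      case False
      then have "unskip p j \<in> {1..n}" using j assms by (auto simp: unskip_def)
      then show ?thesis using False by (metis image_eqI insertI2 skip_unskip)
    qed simp
  qed
qed (use assms skip_range in auto)

lemma permutesI_bij: "bij f \<Longrightarrow> (\<And>x. x \<notin> S \<Longrightarrow> f x = x) \<Longrightarrow> f permutes S"
  by (simp add: permutes_def bij_iff)

text \<open>Transposing the matrix exchanges position and value, so the inverse is
  \<open>insert_at v p (inv \<tau>)\<close>. The bounds on \<open>p\<close> and \<open>v\<close>
  make the two renumberings cancel outside \<open>{1..Suc n}\<close>.\<close>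

lemma insert_at_permutes:
  assumes "\<tau> permutes {1..n}" "p \<in> {1..Suc n}" "v \<in> {1..Suc n}"
  shows "insert_at p v \<tau> permutes {1..Suc n}"
proof (rule permutesI_bij)
  have inv: "\<tau> (inv \<tau> x) = x" "inv \<tau> (\<tau> x) = x" for x
    using permutes_inverses[OF assms(1)] by auto
  have A: "insert_at p v \<tau> (insert_at v p (inv \<tau>) x) = x" for x
    by (cases "x = v") (auto simp: insert_at_def inv)
  have B: "insert_at v p (inv \<tau>) (insert_at p v \<tau> x) = x" for x
    by (cases "x = p") (auto simp: insert_at_def inv)
  show "bij (insert_at p v \<tau>)"
    by (rule o_bij[of "insert_at v p (inv \<tau>)"]) (auto simp: A B)
next
  fix x assume x: "x \<notin> {1..Suc n}"
  then have "unskip p x \<notin> {1..n}" using assms by (auto simp: unskip_def)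
  then have "\<tau> (unskip p x) = unskip p x" using assms(1) by (auto simp: permutes_def)
  then show "insert_at p v \<tau> x = x"
    using x assms by (auto simp: insert_at_def skip_def unskip_def)
qed

lemma delete_at_permutes:
  assumes "\<sigma> permutes {1..Suc n}" "p \<in> {1..Suc n}" "\<sigma> p = v"
  shows "delete_at p v \<sigma> permutes {1..n}"
proof (rule permutesI_bij)
  have v: "v \<in> {1..Suc n}" using permutes_in_image[OF assms(1), of p] assms(2,3) by simp
  have inv: "\<sigma> (inv \<sigma> x) = x" "inv \<sigma> (\<sigma> x) = x" for x
    using permutes_inverses[OF assms(1)] by auto
  have neq1: "\<sigma> (skip p x) \<noteq> v" for x
    by (metis assms(3) inv(2) skip_neq(1))
  have neq2: "inv \<sigma> (skip v x) \<noteq> p" for x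
    by (metis assms(3) inv(1) skip_neq(1))
  have A: "delete_at p v \<sigma> (delete_at v p (inv \<sigma>) x) = x" for x
    unfolding delete_at_def skip_unskip[OF neq2] inv(1) by simp
  have B: "delete_at v p (inv \<sigma>) (delete_at p v \<sigma> x) = x" for x
    unfolding delete_at_def skip_unskip[OF neq1] inv(2) by simp
  show "bij (delete_at p v \<sigma>)"
    by (rule o_bij[of "delete_at v p (inv \<sigma>)"]) (auto simp: A B)
  fix x assume x: "x \<notin> {1..n}"
  then have "skip p x \<notin> {1..Suc n}" using assms by (auto simp: skip_def)
  then have "\<sigma> (skip p x) = skip p x" using assms(1) by (auto simp: permutes_def)
  moreover have "unskip v (skip p x) = x"
    using x assms(2) v by (auto simp: skip_def unskip_def)
  ultimately show "delete_at p v \<sigma> x = x"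
    by (simp add: delete_at_def)
qed

lemma insert_at_image:
  assumes "p \<in> {1..Suc n}" "v \<in> {1..Suc n}"
  shows "{\<sigma>. \<sigma> permutes {1..Suc n} \<and> \<sigma> p = v} = insert_at p v ` {\<tau>. \<tau> permutes {1..n}}"
proof
  show "{\<sigma>. \<sigma> permutes {1..Suc n} \<and> \<sigma> p = v} \<subseteq> insert_at p v ` {\<tau>. \<tau> permutes {1..n}}"
  proof
    fix \<sigma> assume s: "\<sigma> \<in> {\<sigma>. \<sigma> permutes {1..Suc n} \<and> \<sigma> p = v}"
    have "\<sigma> = insert_at p v (delete_at p v \<sigma>)"
      using s by (intro insert_delete_at[symmetric]) (auto intro: permutes_inj)
    moreover have "delete_at p v \<sigma> permutes {1..n}"
      using s assms by (intro delete_at_permutes) auto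
    ultimately show "\<sigma> \<in> insert_at p v ` {\<tau>. \<tau> permutes {1..n}}" by blast
  qed
qed (use insert_at_permutes assms in auto)

text \<open>Insertion at a prescribed place is a bijection onto the permutations having that entry.
  It is applied with the largest value, \<open>v = Suc n\<close>, for the multinomial recursion, and
  with \<open>v = p\<close> for fixed points.\<close>

lemma card_insert_at:
  assumes "p \<in> {1..Suc n}" "v \<in> {1..Suc n}"
    and "\<And>\<tau>. \<tau> permutes {1..n} \<Longrightarrow> P (insert_at p v \<tau>) \<longleftrightarrow> Q \<tau>"
  shows "card {\<sigma>. \<sigma> permutes {1..Suc n} \<and> \<sigma> p = v \<and> P \<sigma>} = card {\<tau>. \<tau> permutes {1..n} \<and> Q \<tau>}"
proof -
  have "{\<sigma>. \<sigma> permutes {1..Suc n} \<and> \<sigma> p = v \<and> P \<sigma>}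
      = {\<sigma> \<in> {\<sigma>. \<sigma> permutes {1..Suc n} \<and> \<sigma> p = v}. P \<sigma>}" by auto
  also have "\<dots> = insert_at p v ` {\<tau>. \<tau> permutes {1..n} \<and> Q \<tau>}"
    unfolding insert_at_image[OF assms(1,2)] using assms(3) by auto
  finally show ?thesis
    by (simp add: card_image inj_on_inverseI[of _ "delete_at p v"])
qed

section \<open>Permutations decreasing on colour classes, and their weights\<close>

text \<open>Segments are encoded as the fibres of a colouring \<open>c\<close> of the positions. The colours need not
  increase with the position, so the segments of size one can be given colours beyond those of
  the variables.\<close>

definition dec_perms :: "nat \<Rightarrow> (nat \<Rightarrow> 'c) \<Rightarrow> (nat \<Rightarrow> nat) set" where
  "dec_perms n c = {\<sigma>. \<sigma> permutes {1..n} \<and>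
     (\<forall>i\<in>{1..n}. \<forall>j\<in>{1..n}. i < j \<longrightarrow> c i = c j \<longrightarrow> \<sigma> j < \<sigma> i)}"

text \<open>Segments are intervals of positions. The multinomial count of \<open>dec_perms\<close>
  holds for arbitrary fibres; intervals enter with the deletion of fixed points and with the
  translation from descent sets.\<close>

definition convex_fibres :: "nat \<Rightarrow> (nat \<Rightarrow> 'c) \<Rightarrow> bool" where
  "convex_fibres n c \<longleftrightarrow>
     (\<forall>i\<in>{1..n}. \<forall>j\<in>{1..n}. \<forall>l. i \<le> l \<longrightarrow> l \<le> j \<longrightarrow> c i = c j \<longrightarrow> c l = c i)"

lemma convex_fibresD:
  "convex_fibres n c \<Longrightarrow> i \<in> {1..n} \<Longrightarrow> j \<in> {1..n} \<Longrightarrow> i \<le> l \<Longrightarrow> l \<le> j \<Longrightarrow> c i = c j \<Longrightarrow> c l = c i"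
  unfolding convex_fibres_def by blast

lemma dec_permsD:
  "\<sigma> \<in> dec_perms n c \<Longrightarrow> i \<in> {1..n} \<Longrightarrow> j \<in> {1..n} \<Longrightarrow> i < j \<Longrightarrow> c i = c j \<Longrightarrow> \<sigma> j < \<sigma> i"
  by (simp add: dec_perms_def)

lemma finite_dec_perms [simp]: "finite (dec_perms n c)"
  by (rule finite_subset[OF _ finite_permutations[of "{1..n}"]]) (auto simp: dec_perms_def)

text \<open>Old entries keep their relative order, so only comparisons with the new entry matter. An
  old value \<open>x\<close> lands above \<open>v\<close> when \<open>v \<le> x\<close> and below it
  when \<open>x < v\<close>, since \<open>skip v\<close> moves the value \<open>v\<close> itself up;
  this explains the weak and the strict inequality.\<close>

lemma insert_at_dec_iff:
  assumes "\<tau> permutes {1..n}" "p \<in> {1..Suc n}" "v \<in> {1..Suc n}"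
  shows "insert_at p v \<tau> \<in> dec_perms (Suc n) c \<longleftrightarrow> \<tau> \<in> dec_perms n (c \<circ> skip p) \<and>
    (\<forall>j\<in>{1..n}. c (skip p j) = c p \<longrightarrow> (if j < p then v \<le> \<tau> j else \<tau> j < v))"
proof -
  have 1: "skip v x < v \<longleftrightarrow> x < v" "v < skip v x \<longleftrightarrow> v \<le> x" for v x
    by (auto simp: skip_def)
  have 2: "p < skip p x \<longleftrightarrow> \<not> x < p" for x
    by (auto simp: skip_def)
  have 3: "insert_at p v \<tau> permutes {1..Suc n}"
    using insert_at_permutes assms by blast
  show ?thesis
    unfolding dec_perms_def range_Suc_skip[OF assms(2)]
    using 3 assms(1) unfolding range_Suc_skip[OF assms(2)]
    by (auto simp: 1 2)
qed

text \<open>Colours double as indices of variables, so a colouring has a monomial. The sum form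
  makes the deletion of a position \<open>p\<close> strip one factor of index \<open>c p\<close>,
  which matches multiplication by \<open>mX (c p)\<close>.\<close>

definition weight :: "nat \<Rightarrow> (nat \<Rightarrow> nat) \<Rightarrow> nat \<Rightarrow>\<^sub>0 nat" where
  "weight n c = (\<Sum>j\<in>{1..n}. Poly_Mapping.single (c j) 1)"

lemma weight_Suc:
  assumes "p \<in> {1..Suc n}"
  shows "weight (Suc n) c = Poly_Mapping.single (c p) 1 + weight n (c \<circ> skip p)"
proof -
  have "p \<notin> skip p ` {1..n}" "inj_on (skip p) {1..n}"
    by (auto simp: inj_on_def)
  then show ?thesis
    unfolding weight_def range_Suc_skip[OF assms] by (simp add: sum.reindex)
qed

lemma lookup_weight: "Poly_Mapping.lookup (weight n c) i = card {j\<in>{1..n}. c j = i}"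
proof -
  have "Poly_Mapping.lookup (weight n c) i = (\<Sum>j\<in>{1..n}. if c j = i then 1 else 0)"
    unfolding weight_def lookup_sum by (rule sum.cong) (auto simp: lookup_single when_def)
  also have "\<dots> = card {j\<in>{1..n}. c j = i}"
    by (simp add: sum.If_cases Int_def)
  finally show ?thesis .
qed

lemma convex_fibres_skip:
  assumes "convex_fibres (Suc n) c" "p \<in> {1..Suc n}"
  shows "convex_fibres n (c \<circ> skip p)"
  unfolding convex_fibres_def
proof (intro ballI allI impI)
  fix i j l assume *: "i \<in> {1..n}" "j \<in> {1..n}" "i \<le> l" "l \<le> j" "(c \<circ> skip p) i = (c \<circ> skip p) j"
  have "skip p i \<le> skip p l" "skip p l \<le> skip p j"
    using * by (auto simp: skip_def)
  then show "(c \<circ> skip p) l = (c \<circ> skip p) i"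
    using convex_fibresD[OF assms(1) skip_range[OF assms(2) *(1)] skip_range[OF assms(2) *(2)]] *(5)
    unfolding o_apply by blast
qed

text \<open>Classification by the colour of the position of the largest value, which must be the first
  position of that colour.\<close>

lemma card_dec_perms_Suc:
  fixes c :: "nat \<Rightarrow> 'c"
  assumes "\<And>i. i \<in> c ` {1..Suc n} \<Longrightarrow>
      f i \<in> {1..Suc n} \<and> c (f i) = i \<and> (\<forall>j\<in>{1..<f i}. c j \<noteq> i)"
  shows "card (dec_perms (Suc n) c) = (\<Sum>i\<in>c ` {1..Suc n}. card (dec_perms n (c \<circ> skip (f i))))"
proof -
  let ?X = "\<lambda>i. {\<sigma>. \<sigma> permutes {1..Suc n} \<and> \<sigma> (f i) = Suc n \<and> \<sigma> \<in> dec_perms (Suc n) c}"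
  have "dec_perms (Suc n) c \<subseteq> (\<Union>i\<in>c ` {1..Suc n}. ?X i)"
  proof
    fix \<sigma> assume s: "\<sigma> \<in> dec_perms (Suc n) c"
    then have perm: "\<sigma> permutes {1..Suc n}" by (simp add: dec_perms_def)
    define q where "q = inv \<sigma> (Suc n)"
    have q: "\<sigma> q = Suc n" using permutes_inverses(1)[OF perm] by (simp add: q_def)
    have qr: "q \<in> {1..Suc n}" using permutes_in_image[OF perm, of q] q by simp
    note f = assms[OF imageI[OF qr]]
    have "f (c q) = q"
    proof (rule ccontr)
      assume "f (c q) \<noteq> q"
      moreover have "\<not> q < f (c q)" using f qr by auto
      ultimately have "f (c q) < q" by simp
      then have "Suc n < \<sigma> (f (c q))"
        using dec_permsD[OF s, of "f (c q)" q] f q qr by auto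
      moreover have "\<sigma> (f (c q)) \<in> {1..Suc n}" using f permutes_in_image[OF perm] by blast
      ultimately show False by simp
    qed
    then have "\<sigma> \<in> ?X (c q)" using s q perm by simp
    then show "\<sigma> \<in> (\<Union>i\<in>c ` {1..Suc n}. ?X i)" using qr by blast
  qed
  then have "dec_perms (Suc n) c = (\<Union>i\<in>c ` {1..Suc n}. ?X i)" by auto
  also have "card \<dots> = (\<Sum>i\<in>c ` {1..Suc n}. card (?X i))"
  proof (rule card_UN_disjoint)
    show "\<forall>i\<in>c ` {1..Suc n}. \<forall>j\<in>c ` {1..Suc n}. i \<noteq> j \<longrightarrow> ?X i \<inter> ?X j = {}"
    proof (intro ballI impI)
      fix i j assume ij: "i \<in> c ` {1..Suc n}" "j \<in> c ` {1..Suc n}" "i \<noteq> j"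
      then have "f i \<noteq> f j" using assms by metis
      moreover have "f i = f j" if "\<sigma> permutes {1..Suc n}" "\<sigma> (f i) = Suc n" "\<sigma> (f j) = Suc n" for \<sigma>
        using permutes_inj[OF that(1)] that(2,3) by (metis injD)
      ultimately show "?X i \<inter> ?X j = {}" by blast
    qed
  qed (auto intro: finite_subset[OF _ finite_dec_perms])
  also have "\<dots> = (\<Sum>i\<in>c ` {1..Suc n}. card (dec_perms n (c \<circ> skip (f i))))"
  proof (rule sum.cong[OF refl])
    fix i assume "i \<in> c ` {1..Suc n}"
    note f = assms[OF this]
    have "card (?X i) = card {\<tau>. \<tau> permutes {1..n} \<and> \<tau> \<in> dec_perms n (c \<circ> skip (f i))}"
    proof (rule card_insert_at)
      fix \<tau> :: "nat \<Rightarrow> nat" assume t: "\<tau> permutes {1..n}"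
      have lt: "\<tau> j < Suc n" if "j \<in> {1..n}" for j
        using permutes_in_image[OF t, of j] that by auto
      \<comment> \<open>As \<open>f i\<close> is the first position of its colour, only later
        positions are compared with the new entry, and these carry values below \<open>Suc n\<close>
        in any case.\<close>
      have "\<not> j < f i" if "j \<in> {1..n}" "c (skip (f i) j) = c (f i)" for j
        using f that by (auto simp: skip_def split: if_splits)
      then show "insert_at (f i) (Suc n) \<tau> \<in> dec_perms (Suc n) c \<longleftrightarrow> \<tau> \<in> dec_perms n (c \<circ> skip (f i))"
        using insert_at_dec_iff[OF t, of "f i" "Suc n" c] f lt by auto
    qed (use f in auto)
    also have "{\<tau>. \<tau> permutes {1..n} \<and> \<tau> \<in> dec_perms n (c \<circ> skip (f i))} = dec_perms n (c \<circ> skip (f i))"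
      by (auto simp: dec_perms_def)
    finally show "card (?X i) = card (dec_perms n (c \<circ> skip (f i)))" .
  qed
  finally show ?thesis .
qed

section \<open>Deleting the fixed point of a colour class\<close>

lemma dec_perms_cong:
  "(\<And>j. j \<in> {1..n} \<Longrightarrow> c j = d j) \<Longrightarrow> dec_perms n c = dec_perms n d"
  unfolding dec_perms_def by (intro Collect_cong conj_cong refl ball_cong) simp_all

lemma fixed_points_insert_at:
  assumes "p \<in> {1..Suc n}"
  shows "fixed_points (Suc n) (insert_at p p \<tau>) = insert p (skip p ` fixed_points n \<tau>)"
  unfolding fixed_points_def range_Suc_skip[OF assms] by auto

text \<open>Both sides are disjoint unions over the positions \<open>p\<close> of the fibre of
  \<open>c p0\<close>: on the left \<open>p\<close> is the unique fixed point of that fibre, on the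
  right the unique slot where a fixed point can be inserted. \<open>insert_at p p\<close> matches
  the pieces. \<open>P\<close> carries conditions on the other colours, whose fixed points are
  renumbered but neither created nor destroyed.\<close>

lemma card_remove_fixed:
  fixes c :: "nat \<Rightarrow> 'c"
  assumes conv: "convex_fibres (Suc n) c" and p0: "p0 \<in> {1..Suc n}"
  shows "card {\<sigma> \<in> dec_perms (Suc n) c. c p0 \<in> c ` fixed_points (Suc n) \<sigma> \<and>
                  P (c ` fixed_points (Suc n) \<sigma> - {c p0})} =
         card {\<tau> \<in> dec_perms n (c \<circ> skip p0). c p0 \<notin> (c \<circ> skip p0) ` fixed_points n \<tau> \<and>
                  P ((c \<circ> skip p0) ` fixed_points n \<tau>)}"
proof -
  define i where "i = c p0"
  define c' where "c' = c \<circ> skip p0"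
  define F where "F = {p\<in>{1..Suc n}. c p = i}"
  \<comment> \<open>\<open>gap p \<tau>\<close>: inserting a fixed point \<open>p\<close> into \<open>\<tau>\<close> keeps the fibre of \<open>i\<close> decreasing.\<close>
  define gap where "gap p \<tau> \<longleftrightarrow>
    (\<forall>j\<in>{1..n}. c' j = i \<longrightarrow> (if j < p then p \<le> \<tau> j else \<tau> j < p))" for p and \<tau> :: "nat \<Rightarrow> nat"
  \<comment> \<open>The fibre is an interval, so deleting any of its positions leaves the same
    colouring of \<open>{1..n}\<close>. This is why a single \<open>p0\<close> can stand for all
    choices of \<open>p\<close>.\<close>
  have skip_c: "c (skip p j) = c' j" if "p \<in> F" "j \<in> {1..n}" for p j
  proof -
    have "c (skip q j) = c (skip r j)" if "q \<in> F" "r \<in> F" "q \<le> r" for q r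
    proof (cases "j < q \<or> r \<le> j")
      case False
      have "c l = i" if "q \<le> l" "l \<le> r" for l
        using convex_fibresD[OF conv, of q r l] \<open>q \<in> F\<close> \<open>r \<in> F\<close> that by (auto simp: F_def)
      then show ?thesis using False by (auto simp: skip_def)
    qed (use that in \<open>auto simp: skip_def\<close>)
    moreover have "p0 \<in> F" using p0 by (auto simp: F_def i_def)
    ultimately show ?thesis using that(1) unfolding c'_def o_def by (metis nle_le)
  qed
  have fibre: "skip p j \<in> F" if "p \<in> F" "j \<in> {1..n}" "c' j = i" for p j
    using skip_c[OF that(1,2)] that skip_range[of p n j] by (auto simp: F_def)
  \<comment> \<open>The fibre loses its last position in the renumbering: if \<open>F\<close> is
    \<open>{x..y}\<close>, then \<open>c'\<close> has colour \<open>i\<close> on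
    \<open>{x..<y}\<close>. Hence the strict bound \<open>j < q\<close>.\<close>
  have fibre': "c' j = i" if "p \<in> F" "q \<in> F" "p \<le> j" "j < q" for p q j
  proof -
    have "c (skip p j) = i"
      using convex_fibresD[OF conv, of p q "skip p j"] that by (auto simp: F_def skip_def)
    then show ?thesis using skip_c[OF that(1), of j] that by (auto simp: F_def)
  qed
  define Q where "Q \<tau> \<longleftrightarrow> i \<notin> c' ` fixed_points n \<tau> \<and> P (c' ` fixed_points n \<tau>)" for \<tau>
  let ?X = "\<lambda>p. {\<sigma>. \<sigma> permutes {1..Suc n} \<and> \<sigma> p = p \<and>
                  (\<sigma> \<in> dec_perms (Suc n) c \<and> P (c ` fixed_points (Suc n) \<sigma> - {i}))}"
  let ?Y = "\<lambda>p. {\<tau>. \<tau> permutes {1..n} \<and> (\<tau> \<in> dec_perms n c' \<and> gap p \<tau> \<and> Q \<tau>)}"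
  \<comment> \<open>A fixed point \<open>j\<close> of colour \<open>i\<close> would have to satisfy
    \<open>p \<le> j\<close> if \<open>j < p\<close>, and \<open>j < p\<close> otherwise.\<close>
  have gap_no: "i \<notin> c' ` fixed_points n \<tau>" if "gap p \<tau>" for p \<tau>
    using that by (auto simp: gap_def fixed_points_def split: if_splits)
  have "card (?X p) = card (?Y p)" if p: "p \<in> F" for p
  proof (rule card_insert_at)
    show pr: "p \<in> {1..Suc n}" "p \<in> {1..Suc n}" using p by (auto simp: F_def)
    fix \<tau> :: "nat \<Rightarrow> nat" assume t: "\<tau> permutes {1..n}"
    have "dec_perms n (c \<circ> skip p) = dec_perms n c'"
      by (rule dec_perms_cong) (use skip_c p in auto)
    then have 1: "insert_at p p \<tau> \<in> dec_perms (Suc n) c \<longleftrightarrow> \<tau> \<in> dec_perms n c' \<and> gap p \<tau>"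
      using insert_at_dec_iff[OF t pr, of c] p skip_c[OF p] by (auto simp: gap_def F_def)
    have "c ` skip p ` fixed_points n \<tau> = c' ` fixed_points n \<tau>"
      unfolding image_image by (rule image_cong) (use skip_c[OF p] in \<open>auto simp: fixed_points_def\<close>)
    then have 2: "c ` fixed_points (Suc n) (insert_at p p \<tau>) = insert i (c' ` fixed_points n \<tau>)"
      using p by (simp add: fixed_points_insert_at[OF pr(1)] F_def)
    show "insert_at p p \<tau> \<in> dec_perms (Suc n) c \<and> P (c ` fixed_points (Suc n) (insert_at p p \<tau>) - {i})
        \<longleftrightarrow> \<tau> \<in> dec_perms n c' \<and> gap p \<tau> \<and> Q \<tau>"
      unfolding 1 2 Q_def using gap_no[of p \<tau>] by auto
  qed
  moreover have "card (\<Union>p\<in>F. ?X p) = (\<Sum>p\<in>F. card (?X p))"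
  proof (rule card_UN_disjoint)
    have "\<not> (\<sigma> \<in> dec_perms (Suc n) c \<and> \<sigma> p = p \<and> \<sigma> q = q)" if "p \<in> F" "q \<in> F" "p < q" for p q \<sigma>
      using dec_permsD[of \<sigma> "Suc n" c p q] that by (auto simp: F_def)
    then have disj: "?X p \<inter> ?X q = {}" if "p \<in> F" "q \<in> F" "p < q" for p q
      using that by blast
    show "\<forall>p\<in>F. \<forall>q\<in>F. p \<noteq> q \<longrightarrow> ?X p \<inter> ?X q = {}"
    proof (intro ballI impI)
      fix p q assume pq: "p \<in> F" "q \<in> F" "p \<noteq> q"
      then consider "p < q" | "q < p" by linarith
      then show "?X p \<inter> ?X q = {}"
        by cases (use pq disj[of p q] disj[of q p] in blast)+
    qed
  qed (auto simp: F_def intro: finite_subset[OF _ finite_dec_perms])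
  moreover have "card (\<Union>p\<in>F. ?Y p) = (\<Sum>p\<in>F. card (?Y p))"
  proof (rule card_UN_disjoint)
    \<comment> \<open>Position \<open>p\<close> tells two slots apart: slot \<open>p\<close> forces
      \<open>\<tau> p < p\<close>, whereas the later slot \<open>q\<close> forces
      \<open>q \<le> \<tau> p\<close>.\<close>
    have "\<not> (gap p \<tau> \<and> gap q \<tau>)" if "p \<in> F" "q \<in> F" "p < q" for p q \<tau>
    proof -
      have "p \<in> {1..n}" using that by (auto simp: F_def)
      then show ?thesis using fibre'[of p q p] that by (force simp: gap_def)
    qed
    then have disj: "?Y p \<inter> ?Y q = {}" if "p \<in> F" "q \<in> F" "p < q" for p q
      using that by blast
    show "\<forall>p\<in>F. \<forall>q\<in>F. p \<noteq> q \<longrightarrow> ?Y p \<inter> ?Y q = {}"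
    proof (intro ballI impI)
      fix p q assume pq: "p \<in> F" "q \<in> F" "p \<noteq> q"
      then consider "p < q" | "q < p" by linarith
      then show "?Y p \<inter> ?Y q = {}"
        by cases (use pq disj[of p q] disj[of q p] in blast)+
    qed
  qed (auto simp: F_def intro: finite_subset[OF _ finite_dec_perms])
  moreover have "(\<Union>p\<in>F. ?X p) = {\<sigma> \<in> dec_perms (Suc n) c. i \<in> c ` fixed_points (Suc n) \<sigma> \<and>
                  P (c ` fixed_points (Suc n) \<sigma> - {i})}"
    by (auto simp: F_def fixed_points_def dec_perms_def image_iff)
  moreover have "(\<Union>p\<in>F. ?Y p) = {\<tau> \<in> dec_perms n c'. Q \<tau>}"
  proof
    show "{\<tau> \<in> dec_perms n c'. Q \<tau>} \<subseteq> (\<Union>p\<in>F. ?Y p)"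
    proof
      fix \<tau> assume t: "\<tau> \<in> {\<tau> \<in> dec_perms n c'. Q \<tau>}"
      then have d: "\<tau> \<in> dec_perms n c'" by simp
      have nofix: "\<tau> j \<noteq> j" if "j \<in> {1..n}" "c' j = i" for j
        using t that by (auto simp: Q_def fixed_points_def image_iff)
      \<comment> \<open>The slot is the first non-excedance of the fibre, or its end if there is none.\<close>
      define G where "G = {p\<in>F. p = Max F \<or> \<tau> p < p}"
      have F: "finite F" "F \<noteq> {}" using p0 by (auto simp: F_def i_def)
      then have "Max F \<in> G" by (simp add: G_def)
      define p where "p = Min G"
      have G: "finite G" using F by (simp add: G_def)
      then have pG: "p \<in> G" unfolding p_def using \<open>Max F \<in> G\<close> by (intro Min_in) auto
      then have pF: "p \<in> F" by (simp add: G_def)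
      have "gap p \<tau>"
        unfolding gap_def
      proof (intro ballI impI)
        fix j assume j: "j \<in> {1..n}" "c' j = i"
        show "if j < p then p \<le> \<tau> j else \<tau> j < p"
        proof (cases "j < p")
          case True
          have jF: "j \<in> F" using fibre[OF pF j] True by (simp add: skip_def)
          have q: "c' (p - 1) = i" "p - 1 \<in> {1..n}"
            using fibre'[OF jF pF, of "p - 1"] True pF j by (auto simp: F_def)
          have "p - 1 \<in> F" using fibre[OF pF q(2,1)] True by (simp add: skip_def)
          \<comment> \<open>By minimality of \<open>p\<close>, position \<open>p - 1\<close> is not
            an anti-excedance; not being fixed, it is an excedance. Earlier positions of the fibre
            carry larger values still.\<close>
          moreover have "p - 1 \<notin> G" using Min_le[OF G, of "p - 1"] True unfolding p_def by auto
          ultimately have "p - 1 \<le> \<tau> (p - 1)" by (auto simp: G_def)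
          then have "p \<le> \<tau> (p - 1)" using nofix[OF q(2,1)] by linarith
          moreover have "\<tau> (p - 1) \<le> \<tau> j"
          proof (cases "j = p - 1")
            case False
            then have "j < p - 1" using True by linarith
            then show ?thesis using dec_permsD[OF d j(1) q(2)] q(1) j(2) by simp
          qed simp
          ultimately show ?thesis using True by simp
        next
          case False
          \<comment> \<open>A position of the fibre at or after \<open>p\<close> shows that
            \<open>p\<close> is not the end slot, so \<open>p\<close> lies in \<open>G\<close>
            because it is an anti-excedance; later values are smaller still.\<close>
          have "Suc j \<in> F" using fibre[OF pF j] False by (simp add: skip_def)
          then have M: "Suc j \<le> Max F" using F(1) by simp
          then have "\<tau> p < p" using pG False by (auto simp: G_def)
          moreover have "\<tau> j \<le> \<tau> p"
          proof (cases "j = p")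
            case neq: False
            have "c' p = i" using fibre'[OF pF \<open>Suc j \<in> F\<close>, of p] False by simp
            then show ?thesis using dec_permsD[OF d _ j(1), of p] neq False pF j by (auto simp: F_def)
          qed simp
          ultimately show ?thesis using False by simp
        qed
      qed
      then show "\<tau> \<in> (\<Union>p\<in>F. ?Y p)" using t pF by (auto simp: dec_perms_def)
    qed
  qed auto
  ultimately show ?thesis
    unfolding i_def[symmetric] c'_def[symmetric] Q_def by simp
qed

section \<open>Coefficients of the series as counts\<close>

lemma mcoeff_mX_mult:
  fixes f :: "'a :: comm_ring_1 mfps"
  shows "mcoeff (mX i * f) (Poly_Mapping.single i 1 + m) = mcoeff f m"
proof -
  have "mcoeff (mX i * f) (Poly_Mapping.single i 1 + m) =
      (\<Sum>u\<in>{(Poly_Mapping.single i 1, m)}. mcoeff (mX i) (fst u) * mcoeff f (snd u))"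
    unfolding times_mfps.rep_eq split_beta
    by (rule sum.mono_neutral_right, rule finite_splits) (auto simp: splits_def mX.rep_eq)
  then show ?thesis by (simp add: mX.rep_eq)
qed

lemma mcoeff_mX_mult_eq_0:
  fixes f :: "'a :: comm_ring_1 mfps"
  assumes "Poly_Mapping.lookup m i = 0"
  shows "mcoeff (mX i * f) m = 0"
  unfolding times_mfps.rep_eq split_beta
proof (rule sum.neutral, rule ballI)
  fix u assume "u \<in> splits m"
  then have "Poly_Mapping.lookup (fst u) i + Poly_Mapping.lookup (snd u) i = 0"
    using assms by (auto simp: splits_def lookup_add)
  then have "fst u \<noteq> Poly_Mapping.single i 1" by auto
  then show "mcoeff (mX i) (fst u) * mcoeff f (snd u) = 0" by (simp add: mX.rep_eq)
qed

lemma mcoeff_sum: "mcoeff (sum f A) m = (\<Sum>x\<in>A. mcoeff (f x) m)"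
  by (induction A rule: infinite_finite_induct) (simp_all add: zero_mfps.rep_eq plus_mfps.rep_eq)

lemma lookup_weight_eq_0:
  "i \<notin> c ` {1..n} \<Longrightarrow> Poly_Mapping.lookup (weight n c) i = 0"
  by (auto simp: lookup_weight)

text \<open>The equation says that \<open>B\<close> equals 1 plus the sum of the
  \<open>mX i * B\<close>. Comparing coefficients gives a recursion over the colours present, the
  same one as \<open>card_dec_perms_Suc\<close> gives for the count.\<close>

lemma mcoeff_dec_perms:
  fixes B :: "'a :: comm_ring_1 mfps"
  assumes "(1 - (\<Sum>i<k. mX i)) * B = 1" "c ` {1..n} \<subseteq> {..<k}"
  shows "mcoeff B (weight n c) = of_nat (card (dec_perms n c))"
  using assms(2)
proof (induction n arbitrary: c)
  case 0
  have "mcoeff B 0 = 1"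
  proof -
    have "mcoeff ((1 - (\<Sum>i<k. mX i)) * B) 0 = mcoeff B 0"
      by (simp add: left_diff_distrib sum_distrib_right minus_mfps.rep_eq mcoeff_sum mcoeff_mX_mult_eq_0)
    then show ?thesis unfolding assms(1) by (simp add: one_mfps.rep_eq)
  qed
  moreover have "dec_perms 0 c = {id}" by (auto simp: dec_perms_def)
  ultimately show ?case by (simp add: weight_def)
next
  case (Suc n)
  define f where "f i = (LEAST j. j \<in> {1..Suc n} \<and> c j = i)" for i
  have f: "f i \<in> {1..Suc n} \<and> c (f i) = i \<and> (\<forall>j\<in>{1..<f i}. c j \<noteq> i)"
    if "i \<in> c ` {1..Suc n}" for i
  proof -
    have 1: "f i \<in> {1..Suc n} \<and> c (f i) = i"
      unfolding f_def by (rule LeastI_ex) (use that in auto)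
    moreover have "c j \<noteq> i" if "j \<in> {1..<f i}" for j
      using not_less_Least[of j "\<lambda>j. j \<in> {1..Suc n} \<and> c j = i"] that 1 unfolding f_def[symmetric] by auto
    ultimately show ?thesis by blast
  qed
  \<comment> \<open>This removes the contribution of the summand 1.\<close>
  have "weight (Suc n) c \<noteq> 0"
  proof
    assume "weight (Suc n) c = 0"
    then have "{j\<in>{1..Suc n}. c j = c 1} = {}" using lookup_weight[of "Suc n" c "c 1"] by simp
    then show False by auto
  qed
  moreover have "B = 1 + (\<Sum>i<k. mX i * B)"
    using assms(1) by (simp add: left_diff_distrib sum_distrib_right diff_eq_eq)
  then have "mcoeff B (weight (Suc n) c) = mcoeff (1 + (\<Sum>i<k. mX i * B)) (weight (Suc n) c)"
    by simp
  ultimately have "mcoeff B (weight (Suc n) c) = (\<Sum>i<k. mcoeff (mX i * B) (weight (Suc n) c))"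
    by (simp add: plus_mfps.rep_eq one_mfps.rep_eq mcoeff_sum)
  also have "\<dots> = (\<Sum>i\<in>c ` {1..Suc n}. mcoeff (mX i * B) (weight (Suc n) c))"
    by (rule sum.mono_neutral_right)
       (use Suc.prems in \<open>auto intro!: mcoeff_mX_mult_eq_0 lookup_weight_eq_0\<close>)
  also have "\<dots> = (\<Sum>i\<in>c ` {1..Suc n}. of_nat (card (dec_perms n (c \<circ> skip (f i)))))"
  proof (rule sum.cong[OF refl])
    fix i assume "i \<in> c ` {1..Suc n}"
    note f = f[OF this]
    have "(c \<circ> skip (f i)) ` {1..n} \<subseteq> {..<k}"
      using Suc.prems range_Suc_skip[of "f i" n] f by auto
    then have "mcoeff B (weight n (c \<circ> skip (f i))) = of_nat (card (dec_perms n (c \<circ> skip (f i))))"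
      by (rule Suc.IH)
    moreover have "weight (Suc n) c = Poly_Mapping.single i 1 + weight n (c \<circ> skip (f i))"
      using f weight_Suc[of "f i" n c] by simp
    ultimately show "mcoeff (mX i * B) (weight (Suc n) c) = of_nat (card (dec_perms n (c \<circ> skip (f i))))"
      by (simp only: mcoeff_mX_mult)
  qed
  also have "\<dots> = of_nat (card (dec_perms (Suc n) c))"
    using card_dec_perms_Suc[of c n f] f by simp
  finally show ?case .
qed

text \<open>Colours are forbidden one at a time. When \<open>i\<close> joins \<open>T\<close>, the
  series \<open>(1 + mX i) * A\<close> counts permutations avoiding only \<open>T\<close>. Those
  with a fixed point of colour \<open>i\<close> correspond, by deleting it, to permutations avoiding
  \<open>insert i T\<close> on one position fewer; by the inner induction on \<open>n\<close> these
  are counted by \<open>mX i * A\<close>. What remains is counted by \<open>A\<close>.\<close>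

lemma mcoeff_avoid_fixed:
  fixes A B :: "'a :: comm_ring_1 mfps"
  assumes "finite T" "(1 - (\<Sum>i<k. mX i)) * B = 1" "(\<Prod>i\<in>T. 1 + mX i) * A = B"
    and "convex_fibres n c" "c ` {1..n} \<subseteq> {..<k}"
  shows "mcoeff A (weight n c) = of_nat (card {\<sigma> \<in> dec_perms n c. c ` fixed_points n \<sigma> \<inter> T = {}})"
  using assms(1,3-5)
proof (induction T arbitrary: A n c rule: finite_induct)
  case empty
  then show ?case using mcoeff_dec_perms[OF assms(2), of c n] by simp
next
  case (insert i T)
  have IH: "mcoeff ((1 + mX i) * A) (weight n c) =
      of_nat (card {\<sigma> \<in> dec_perms n c. c ` fixed_points n \<sigma> \<inter> T = {}})"
    if "convex_fibres n c" "c ` {1..n} \<subseteq> {..<k}" for n c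
    using insert.IH[of "(1 + mX i) * A" n c] insert.prems(1) insert.hyps that by (simp add: ac_simps)
  have expand: "mcoeff ((1 + mX i) * A) m = mcoeff A m + mcoeff (mX i * A) m" for m
    by (simp add: distrib_right plus_mfps.rep_eq)
  from insert.prems(2,3) show ?case
  proof (induction n arbitrary: c)
    case 0
    have "mcoeff (mX i * A) (weight 0 c) = 0"
      by (rule mcoeff_mX_mult_eq_0) (simp add: weight_def)
    then show ?case using IH[OF 0] expand by (simp add: fixed_points_def)
  next
    case (Suc n)
    show ?case
    proof (cases "i \<in> c ` {1..Suc n}")
      case False
      then have "{\<sigma> \<in> dec_perms (Suc n) c. c ` fixed_points (Suc n) \<sigma> \<inter> insert i T = {}} =
          {\<sigma> \<in> dec_perms (Suc n) c. c ` fixed_points (Suc n) \<sigma> \<inter> T = {}}"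
        by (auto simp: fixed_points_def)
      moreover have "mcoeff (mX i * A) (weight (Suc n) c) = 0"
        by (intro mcoeff_mX_mult_eq_0 lookup_weight_eq_0 False)
      ultimately show ?thesis
        using IH[OF Suc.prems] expand[of "weight (Suc n) c"] by simp
    next
      case True
      then obtain p where p: "p \<in> {1..Suc n}" "c p = i" by auto
      let ?fc = "\<lambda>\<sigma>. c ` fixed_points (Suc n) \<sigma>"
      let ?d = "c \<circ> skip p"
      have minus_T: "(X - {i}) \<inter> T = X \<inter> T" for X
        using insert.hyps(2) by blast
      have sub: "?d ` {1..n} \<subseteq> {..<k}"
        using Suc.prems range_Suc_skip[OF p(1)] by auto
      have "mcoeff (mX i * A) (weight (Suc n) c) = mcoeff A (weight n ?d)"
        using weight_Suc[OF p(1), of c] p mcoeff_mX_mult by simp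
      also have "\<dots> = of_nat (card {\<tau> \<in> dec_perms n ?d. ?d ` fixed_points n \<tau> \<inter> insert i T = {}})"
        using Suc.IH[OF convex_fibres_skip[OF Suc.prems(1) p(1)] sub] .
      also have "{\<tau> \<in> dec_perms n ?d. ?d ` fixed_points n \<tau> \<inter> insert i T = {}} =
          {\<tau> \<in> dec_perms n ?d. i \<notin> ?d ` fixed_points n \<tau> \<and> ?d ` fixed_points n \<tau> \<inter> T = {}}"
        by auto
      also have "card \<dots> = card {\<sigma> \<in> dec_perms (Suc n) c. i \<in> ?fc \<sigma> \<and> (?fc \<sigma> - {i}) \<inter> T = {}}"
        using card_remove_fixed[OF Suc.prems(1) p(1), of "\<lambda>X. X \<inter> T = {}"] p(2) by simp
      also have "{\<sigma> \<in> dec_perms (Suc n) c. i \<in> ?fc \<sigma> \<and> (?fc \<sigma> - {i}) \<inter> T = {}} =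
          {\<sigma> \<in> dec_perms (Suc n) c. i \<in> ?fc \<sigma> \<and> ?fc \<sigma> \<inter> T = {}}" (is "_ = ?Y")
        by (simp only: minus_T)
      finally have 1: "mcoeff (mX i * A) (weight (Suc n) c) = of_nat (card ?Y)" .
      let ?Z = "{\<sigma> \<in> dec_perms (Suc n) c. ?fc \<sigma> \<inter> insert i T = {}}"
      have "{\<sigma> \<in> dec_perms (Suc n) c. ?fc \<sigma> \<inter> T = {}} = ?Z \<union> ?Y" by blast
      moreover have "card (?Z \<union> ?Y) = card ?Z + card ?Y"
        by (rule card_Un_disjoint) auto
      ultimately show ?thesis
        using IH[OF Suc.prems] expand[of "weight (Suc n) c"] 1 by simp
    qed
  qed
qed

section \<open>Passing from a fixed point in every colour to none\<close>

text \<open>The fixed points are deleted colour by colour, and each treated colour moves from the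
  required set \<open>U\<close> to the forbidden set \<open>T\<close>, which is why the induction
  runs over all \<open>T\<close>. Of the final colouring only convexity and the weight are recorded,
  the latter having lost one factor per colour of \<open>U\<close>.\<close>

lemma remove_fixed_colours:
  assumes "finite U" "U \<inter> T = {}" "U \<subseteq> c ` {1..n}" "convex_fibres n c"
  shows "\<exists>n' c'. convex_fibres n' c' \<and>
    (\<Sum>i\<in>U. Poly_Mapping.single i 1) + weight n' c' = weight n c \<and>
    card {\<sigma> \<in> dec_perms n c. c ` fixed_points n \<sigma> \<inter> T = {} \<and> U \<subseteq> c ` fixed_points n \<sigma>} =
    card {\<sigma> \<in> dec_perms n' c'. c' ` fixed_points n' \<sigma> \<inter> (T \<union> U) = {}}"
  using assms
proof (induction U arbitrary: T n c rule: finite_induct)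
  case empty
  then show ?case by (intro exI[of _ n] exI[of _ c]) auto
next
  case (insert i U)
  obtain p where p: "p \<in> {1..n}" "c p = i" using insert.prems(2) by auto
  then obtain l where n: "n = Suc l" by (cases n) auto
  let ?d = "c \<circ> skip p"
  have p': "p \<in> {1..Suc l}" using p n by simp
  have conv: "convex_fibres (Suc l) c" using insert.prems n by simp
  have minus: "X \<inter> T = {} \<and> insert i U \<subseteq> X \<longleftrightarrow> i \<in> X \<and> (X - {i}) \<inter> T = {} \<and> U \<subseteq> X - {i}" for X
    using insert.prems(1) insert.hyps by blast
  have avoid: "X \<inter> insert i T = {} \<longleftrightarrow> i \<notin> X \<and> X \<inter> T = {}" for X
    by blast
  have "U \<subseteq> ?d ` {1..l}"
  proof
    fix x assume "x \<in> U"
    then have "x \<in> c ` {1..Suc l}" "x \<noteq> c p" using insert.prems(2) insert.hyps p n by auto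
    then show "x \<in> ?d ` {1..l}" unfolding range_Suc_skip[OF p'] by auto
  qed
  moreover have "U \<inter> insert i T = {}" using insert.prems(1) insert.hyps by blast
  ultimately obtain n' c' where *: "convex_fibres n' c'"
    "(\<Sum>i\<in>U. Poly_Mapping.single i 1) + weight n' c' = weight l ?d"
    "card {\<sigma> \<in> dec_perms l ?d. ?d ` fixed_points l \<sigma> \<inter> insert i T = {} \<and> U \<subseteq> ?d ` fixed_points l \<sigma>} =
     card {\<sigma> \<in> dec_perms n' c'. c' ` fixed_points n' \<sigma> \<inter> (insert i T \<union> U) = {}}"
    using insert.IH[OF _ _ convex_fibres_skip[OF conv p'], of "insert i T"] by blast
  have "card {\<sigma> \<in> dec_perms n c. c ` fixed_points n \<sigma> \<inter> T = {} \<and> insert i U \<subseteq> c ` fixed_points n \<sigma>} =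
      card {\<sigma> \<in> dec_perms (Suc l) c. i \<in> c ` fixed_points (Suc l) \<sigma> \<and>
         ((c ` fixed_points (Suc l) \<sigma> - {i}) \<inter> T = {} \<and> U \<subseteq> c ` fixed_points (Suc l) \<sigma> - {i})}"
    by (simp only: n minus)
  also have "\<dots> = card {\<tau> \<in> dec_perms l ?d. i \<notin> ?d ` fixed_points l \<tau> \<and>
      (?d ` fixed_points l \<tau> \<inter> T = {} \<and> U \<subseteq> ?d ` fixed_points l \<tau>)}"
    by (rule card_remove_fixed[OF conv p', of "\<lambda>X. X \<inter> T = {} \<and> U \<subseteq> X", unfolded p(2)])
  also have "\<dots> = card {\<sigma> \<in> dec_perms l ?d. ?d ` fixed_points l \<sigma> \<inter> insert i T = {} \<and>
      U \<subseteq> ?d ` fixed_points l \<sigma>}"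
    by (simp only: avoid conj_assoc)
  also have "\<dots> = card {\<sigma> \<in> dec_perms n' c'. c' ` fixed_points n' \<sigma> \<inter> (T \<union> insert i U) = {}}"
    by (simp only: *(3) Un_insert_left Un_insert_right)
  finally have "card {\<sigma> \<in> dec_perms n c. c ` fixed_points n \<sigma> \<inter> T = {} \<and> insert i U \<subseteq> c ` fixed_points n \<sigma>} =
     card {\<sigma> \<in> dec_perms n' c'. c' ` fixed_points n' \<sigma> \<inter> (T \<union> insert i U) = {}}" .
  moreover have "(\<Sum>i\<in>insert i U. Poly_Mapping.single i 1) + weight n' c' = weight n c"
    using *(2) insert.hyps weight_Suc[OF p', of c] p(2) n by (simp add: add.assoc)
  ultimately show ?case using *(1) by blast
qed

section \<open>Prescribed descents and fixed points in terms of a colouring\<close>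

lemma M_perms_eq:
  assumes conv: "convex_fibres n c" and J: "J \<subseteq> {1..n - 1}"
    and c: "\<And>i. 1 \<le> i \<Longrightarrow> i < n \<Longrightarrow> c i = c (Suc i) \<longleftrightarrow> i \<in> J"
  shows "M_perms n J = {\<sigma> \<in> dec_perms n c. c ` {1..n} \<subseteq> c ` fixed_points n \<sigma>}"
proof -
  \<comment> \<open>The positions outside \<open>J\<close> are the last positions of the fibres,
    hence represent each colour once. This yields \<open>n - card J\<close> colours.\<close>
  have "inj_on c ({1..n} - J)"
  proof (rule linorder_inj_onI')
    fix i j assume ij: "i \<in> {1..n} - J" "j \<in> {1..n} - J" "i < j"
    then have "c i \<noteq> c (Suc i)" using c[of i] by auto
    then show "c i \<noteq> c j"
      using convex_fibresD[OF conv, of i j "Suc i"] ij by auto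
  qed
  moreover have "c ` ({1..n} - J) = c ` {1..n}"
  proof
    show "c ` {1..n} \<subseteq> c ` ({1..n} - J)"
    proof
      fix x assume x: "x \<in> c ` {1..n}"
      define F where "F = {j\<in>{1..n}. c j = x}"
      have F: "finite F" "F \<noteq> {}" using x by (auto simp: F_def)
      then have M: "Max F \<in> F" by (rule Max_in)
      have "Max F \<notin> J"
      proof
        assume "Max F \<in> J"
        then have "Suc (Max F) \<in> F" using M J c[of "Max F"] by (auto simp: F_def)
        then show False using Max_ge[OF F(1), of "Suc (Max F)"] by simp
      qed
      then show "x \<in> c ` ({1..n} - J)" using M
        by (intro image_eqI[of _ _ "Max F"]) (auto simp: F_def)
    qed
  qed auto
  ultimately have "card (c ` {1..n}) = card ({1..n} - J)"
    by (metis card_image)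
  also have "\<dots> = n - card J"
  proof -
    have "J \<subseteq> {1..n}" using J by fastforce
    moreover from this have "finite J" by (rule finite_subset) simp
    ultimately show ?thesis by (simp add: card_Diff_subset)
  qed
  finally have colours: "card (c ` {1..n}) = n - card J" .
  have fix_card: "card (c ` fixed_points n \<sigma>) = card (fixed_points n \<sigma>)" if "\<sigma> \<in> dec_perms n c" for \<sigma>
  proof (rule card_image, rule linorder_inj_onI')
    fix i j assume "i \<in> fixed_points n \<sigma>" "j \<in> fixed_points n \<sigma>" "i < j"
    then show "c i \<noteq> c j" using dec_permsD[OF that, of i j] by (auto simp: fixed_points_def)
  qed
  have fix_sub: "c ` fixed_points n \<sigma> \<subseteq> c ` {1..n}" for \<sigma>
    by (auto simp: fixed_points_def)
  show ?thesis
  proof (intro equalityI subsetI)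
    fix \<sigma> assume s: "\<sigma> \<in> M_perms n J"
    have desc: "\<sigma> (Suc i) < \<sigma> i" if "i \<in> J" for i
      using s that by (auto simp: M_perms_def descent_set_def)
    have "\<sigma> j < \<sigma> i" if ij: "i \<in> {1..n}" "j \<in> {1..n}" "i < j" "c i = c j" for i j
    proof -
      have inJ: "l \<in> J" if "i \<le> l" "l < j" for l
        using convex_fibresD[OF conv ij(1,2), of l] convex_fibresD[OF conv ij(1,2), of "Suc l"]
          c[of l] that ij by auto
      have "i + l < j \<Longrightarrow> \<sigma> (Suc (i + l)) < \<sigma> i" for l
      proof (induction l)
        case 0
        then show ?case using desc[OF inJ, of i] by simp
      next
        case (Suc l)
        then show ?case using desc[OF inJ, of "i + Suc l"] by simp
      qed
      from this[of "j - i - 1"] show ?thesis using ij(3) by simp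
    qed
    then have d: "\<sigma> \<in> dec_perms n c" using s by (auto simp: dec_perms_def M_perms_def)
    have "card (c ` fixed_points n \<sigma>) = card (c ` {1..n})"
      using s fix_card[OF d] colours by (simp add: M_perms_def)
    then have "c ` fixed_points n \<sigma> = c ` {1..n}"
      by (intro card_subset_eq fix_sub) auto
    then show "\<sigma> \<in> {\<sigma> \<in> dec_perms n c. c ` {1..n} \<subseteq> c ` fixed_points n \<sigma>}" using d by simp
  next
    fix \<sigma> assume "\<sigma> \<in> {\<sigma> \<in> dec_perms n c. c ` {1..n} \<subseteq> c ` fixed_points n \<sigma>}"
    then have d: "\<sigma> \<in> dec_perms n c" and sub: "c ` {1..n} \<subseteq> c ` fixed_points n \<sigma>" by auto
    have weak: "\<sigma> j \<le> \<sigma> i" if "i \<in> {1..n}" "j \<in> {1..n}" "i \<le> j" "c i = c j" for i j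
      using dec_permsD[OF d, of i j] that by (cases "i = j") auto
    \<comment> \<open>With fixed points \<open>p\<close> and \<open>q\<close> in the fibres of
      \<open>i\<close> and \<open>Suc i\<close>, convexity puts \<open>p\<close> at or before
      \<open>i\<close> and \<open>q\<close> at or after \<open>Suc i\<close>. Monotonicity on the
      fibres then gives \<open>\<sigma> i \<le> p\<close>, \<open>p < q\<close> and
      \<open>q \<le> \<sigma> (Suc i)\<close>.\<close>
    have asc: "\<not> \<sigma> (Suc i) < \<sigma> i" if i: "1 \<le> i" "i < n" "i \<notin> J" for i
    proof -
      have ne: "c i \<noteq> c (Suc i)" using c i by simp
      have ir: "i \<in> {1..n}" "Suc i \<in> {1..n}" using i by auto
      obtain p where p: "p \<in> {1..n}" "\<sigma> p = p" "c p = c i"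
        using subsetD[OF sub imageI[OF ir(1)]] by (auto simp: fixed_points_def)
      obtain q where q: "q \<in> {1..n}" "\<sigma> q = q" "c q = c (Suc i)"
        using subsetD[OF sub imageI[OF ir(2)]] by (auto simp: fixed_points_def)
      have "p \<le> i" using convex_fibresD[OF conv ir(1) p(1), of "Suc i"] p ne by force
      moreover have "Suc i \<le> q" using convex_fibresD[OF conv q(1) ir(2), of i] q ne by force
      ultimately show ?thesis
        using weak[OF p(1) ir(1)] weak[OF ir(2) q(1)] p q by simp
    qed
    have "descent_set n \<sigma> = J"
    proof (intro equalityI subsetI)
      fix i assume "i \<in> descent_set n \<sigma>"
      then show "i \<in> J" using asc[of i] by (fastforce simp: descent_set_def)
    next
      fix i assume "i \<in> J"
      moreover from this have "1 \<le> i" "i < n" using J by fastforce+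
      ultimately show "i \<in> descent_set n \<sigma>"
        using dec_permsD[OF d, of i "Suc i"] c[of i] by (auto simp: descent_set_def)
    qed
    moreover have "card (fixed_points n \<sigma>) = n - card J"
      using fix_card[OF d] colours sub fix_sub[of \<sigma>] by (metis subset_antisym)
    ultimately show "\<sigma> \<in> M_perms n J" using d by (simp add: M_perms_def dec_perms_def)
  qed
qed

section \<open>The colouring determined by the blocks\<close>

lemma blocks_interval:
  assumes "B \<in> blocks J"
  obtains x y where "B = {x..y}" "x \<le> y" "{x..y} \<subseteq> J"
  using assms by (auto simp: blocks_def runs_def)

text \<open>The union of two overlapping or touching intervals is again a run, so maximality
  identifies both with it. Distinct blocks therefore stay disjoint when each is lengthened by one
  position.\<close>

lemma blocks_adjacent:
  assumes "B \<in> blocks J" "C \<in> blocks J" "i \<in> B" "j \<in> C" "j = i \<or> j = Suc i"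
  shows "B = C"
proof -
  obtain x y where B: "B = {x..y}" "x \<le> y" "{x..y} \<subseteq> J"
    using assms(1) by (rule blocks_interval)
  obtain u v where C: "C = {u..v}" "u \<le> v" "{u..v} \<subseteq> J"
    using assms(2) by (rule blocks_interval)
  have "B \<union> C = {min x u..max y v}"
    using B(1) C(1) assms(3-5) by auto
  moreover have "B \<union> C \<subseteq> J" using B C by simp
  moreover have "min x u \<le> max y v" using B(2) by simp
  ultimately have "B \<union> C \<in> runs J" unfolding runs_def by auto
  then have "B \<union> C = B" "B \<union> C = C"
    using assms(1,2) unfolding blocks_def by auto
  then show ?thesis by simp
qed

lemma Union_blocks:
  assumes "finite J"
  shows "\<Union> (blocks J) = J"
proof
  show "\<Union> (blocks J) \<subseteq> J" by (auto elim: blocks_interval)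
  show "J \<subseteq> \<Union> (blocks J)"
  proof
    fix j assume "j \<in> J"
    then have "{j} \<in> runs J" unfolding runs_def by (auto intro!: exI[of _ j])
    moreover have "finite (runs J)"
      by (rule finite_subset[of _ "Pow J"]) (auto simp: runs_def assms)
    ultimately obtain B where "B \<in> runs J" "{j} \<subseteq> B" "\<forall>C\<in>runs J. B \<subseteq> C \<longrightarrow> B = C"
      using finite_has_maximal2 by metis
    then have "B \<in> blocks J" "j \<in> B" by (auto simp: blocks_def)
    then show "j \<in> \<Union> (blocks J)" by blast
  qed
qed

text \<open>A block of \<open>a\<close> descents spans a decreasing segment of \<open>a + 1\<close>
  positions, and all other segments are singletons. So the weight is one factor for each colour
  times the wanted monomial, and removing one fixed point per colour leaves exactly that
  monomial.\<close>

lemma block_colouring: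
  assumes J: "J \<subseteq> {1..n - 1}"
  obtains c where "convex_fibres n c"
    "\<And>i. 1 \<le> i \<Longrightarrow> i < n \<Longrightarrow> c i = c (Suc i) \<longleftrightarrow> i \<in> J"
    "{..<length (block_sizes J)} \<subseteq> c ` {1..n}"
    "weight n c = (\<Sum>i\<in>c ` {1..n}. Poly_Mapping.single i 1) +
       (\<Sum>i<length (block_sizes J). Poly_Mapping.single i (block_sizes J ! i))"
proof -
  define Bs where "Bs = block_list J"
  define k where "k = length Bs"
  have finJ: "finite J" using J finite_subset by blast
  have set_Bs: "set Bs = blocks J" and sorted: "sorted_wrt (\<lambda>B C. Min B < Min C) Bs"
    unfolding Bs_def using block_list[OF finJ] by auto
  have block: "Bs ! t \<in> blocks J" if "t < k" for t
    using that set_Bs nth_mem unfolding k_def by blast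
  have Bs_inj: "s = t" if "s < k" "t < k" "Bs ! s = Bs ! t" for s t
    using sorted_wrt_nth_less[OF sorted, of s t] sorted_wrt_nth_less[OF sorted, of t s] that
    unfolding k_def by (metis less_irrefl linorder_neqE_nat)
  define E where "E t = Bs ! t \<union> Suc ` (Bs ! t)" for t
  have E_inj: "s = t" if "s < k" "t < k" "j \<in> E s" "j \<in> E t" for s t j
  proof -
    obtain x y where xy: "x \<in> Bs ! s" "j = x \<or> j = Suc x" "y \<in> Bs ! t" "j = y \<or> j = Suc y"
      using \<open>j \<in> E s\<close> \<open>j \<in> E t\<close> unfolding E_def by blast
    then consider "y = x \<or> y = Suc x" | "x = Suc y" by auto
    then have "Bs ! s = Bs ! t"
    proof cases
      case 1
      then show ?thesis using blocks_adjacent[OF block block] that xy by blast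
    next
      case 2
      then show ?thesis using blocks_adjacent[OF block[OF \<open>t < k\<close>] block[OF \<open>s < k\<close>]] xy by metis
    qed
    then show ?thesis using Bs_inj that by blast
  qed
  \<comment> \<open>Positions outside all lengthened blocks get the colour \<open>k + j\<close>:
    injective in \<open>j\<close>, and beyond the indices \<open>{..<k}\<close> of the
    variables.\<close>
  define c where "c j = (if \<exists>t<k. j \<in> E t then THE t. t < k \<and> j \<in> E t else k + j)" for j
  have cE: "c j = t" if "t < k" "j \<in> E t" for j t
  proof -
    have "(THE t. t < k \<and> j \<in> E t) = t"
      by (rule the_equality) (use that E_inj in blast)+
    then show ?thesis using that by (auto simp: c_def)
  qed
  have c_iff: "c j = t \<longleftrightarrow> j \<in> E t" if "t < k" for j t
  proof
    assume "c j = t"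
    then have "\<exists>t<k. j \<in> E t" using that by (auto simp: c_def split: if_splits)
    then show "j \<in> E t" using cE \<open>c j = t\<close> by blast
  qed (use cE that in blast)
  have c_big: "c j = k + j" if "\<not> c j < k" for j
  proof -
    have "\<not> (\<exists>t<k. j \<in> E t)" using cE[of _ j] that by auto
    then show ?thesis unfolding c_def by (rule if_not_P)
  qed
  have E_interval: "\<exists>x y. Bs ! t = {x..y} \<and> x \<le> y \<and> E t = {x..Suc y} \<and> E t \<subseteq> {1..n}" if t: "t < k" for t
  proof -
    obtain x y where xy: "Bs ! t = {x..y}" "x \<le> y" "{x..y} \<subseteq> J"
      using block[OF t] by (rule blocks_interval)
    then have "x \<in> J" "y \<in> J" by auto
    \<comment> \<open>The bound \<open>1 \<le> y\<close> rules out the truncated case of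
      \<open>n - 1\<close>, so that \<open>Suc y \<le> n\<close> follows.\<close>
    then have "1 \<le> x" "y \<le> n - 1" "1 \<le> y" using J by auto
    moreover have "E t = {x..Suc y}"
      unfolding E_def xy(1) image_Suc_atLeastAtMost using xy(2) by auto
    ultimately show ?thesis using xy by auto
  qed
  have conv: "convex_fibres n c"
    unfolding convex_fibres_def
  proof (intro ballI allI impI)
    fix i j l assume *: "i \<le> l" "l \<le> j" "c i = c j"
    show "c l = c i"
    proof (cases "c i < k")
      case True
      then obtain x y where "E (c i) = {x..Suc y}" using E_interval by blast
      moreover have "i \<in> E (c i)" "j \<in> E (c i)" using c_iff[OF True] *(3) by metis+
      ultimately have "l \<in> E (c i)" using * by auto
      then show ?thesis using c_iff[OF True] by simp
    next
      case False
      then have "k + i = k + j" using c_big[of i] c_big[of j] *(3) by metis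
      then show ?thesis using *(1,2) by simp
    qed
  qed
  have c_J: "c i = c (Suc i) \<longleftrightarrow> i \<in> J" for i
  proof
    assume eq: "c i = c (Suc i)"
    have t: "c i < k"
    proof (rule ccontr)
      assume "\<not> c i < k"
      then have "k + i = k + Suc i" using c_big[of i] c_big[of "Suc i"] eq by metis
      then show False by simp
    qed
    obtain x y where xy: "Bs ! c i = {x..y}" "E (c i) = {x..Suc y}" using E_interval[OF t] by blast
    have "i \<in> E (c i)" "Suc i \<in> E (c i)" using c_iff[OF t] eq by metis+
    then have "i \<in> Bs ! c i" using xy by auto
    then show "i \<in> J" using block[OF t] Union_blocks[OF finJ] by blast
  next
    assume "i \<in> J"
    then obtain B where "B \<in> set Bs" "i \<in> B" using Union_blocks[OF finJ] set_Bs by blast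
    then obtain t where t: "t < k" "i \<in> Bs ! t" unfolding k_def by (metis in_set_conv_nth)
    then have "i \<in> E t" "Suc i \<in> E t" by (auto simp: E_def)
    then show "c i = c (Suc i)" using cE t by metis
  qed
  have sizes: "length (block_sizes J) = k" "\<And>t. t < k \<Longrightarrow> block_sizes J ! t = card (Bs ! t)"
    by (auto simp: block_sizes_def k_def Bs_def)
  have fibre: "{j\<in>{1..n}. c j = t} = E t" if "t < k" for t
    using c_iff[OF that] E_interval[OF that] by blast
  have fibre_card: "card {j\<in>{1..n}. c j = t} = Suc (block_sizes J ! t)" if t: "t < k" for t
    unfolding fibre[OF t] using E_interval[OF t] sizes(2)[OF t] by auto
  have range: "{..<k} \<subseteq> c ` {1..n}"
  proof
    fix t assume "t \<in> {..<k}"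
    then have "card {j\<in>{1..n}. c j = t} \<noteq> 0" using fibre_card by simp
    then have "{j\<in>{1..n}. c j = t} \<noteq> {}" by (metis card.empty)
    then show "t \<in> c ` {1..n}" by blast
  qed
  have single_fibre: "card {j\<in>{1..n}. c j = u} = 1" if "\<not> u < k" "u \<in> c ` {1..n}" for u
  proof -
    obtain j where j: "j \<in> {1..n}" "u = c j" using \<open>u \<in> c ` {1..n}\<close> by blast
    have "i = j" if "c i = u" for i
      using that c_big[of i] c_big[of j] j(2) \<open>\<not> u < k\<close> by simp
    then have "{j\<in>{1..n}. c j = u} = {j}" using j by blast
    then show ?thesis by simp
  qed
  have "weight n c = (\<Sum>i\<in>c ` {1..n}. Poly_Mapping.single i 1) +
       (\<Sum>i<k. Poly_Mapping.single i (block_sizes J ! i))"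
  proof (rule poly_mapping_eqI)
    fix u
    have "Poly_Mapping.lookup (\<Sum>i\<in>c ` {1..n}. Poly_Mapping.single i (1::nat)) u =
        (if u \<in> c ` {1..n} then 1 else 0)"
      unfolding lookup_sum lookup_single when_def by (subst sum.delta) auto
    moreover have "Poly_Mapping.lookup (\<Sum>i<k. Poly_Mapping.single i (block_sizes J ! i)) u =
        (if u < k then block_sizes J ! u else 0)"
      unfolding lookup_sum lookup_single when_def by (subst sum.delta) auto
    moreover have "card {j\<in>{1..n}. c j = u} =
        (if u \<in> c ` {1..n} then 1 else 0) + (if u < k then block_sizes J ! u else 0)"
    proof (cases "u < k")
      case True
      then have "u \<in> c ` {1..n}" using range by blast
      then show ?thesis using True fibre_card[OF True] by (simp only: if_True)
    next
      case False
      show ?thesis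
      proof (cases "u \<in> c ` {1..n}")
        case True
        then show ?thesis using False single_fibre[OF False True] by (simp only: if_True if_False)
      next
        case nin: False
        then have "{j\<in>{1..n}. c j = u} = {}" by blast
        then show ?thesis using False nin by (simp only: if_False card.empty)
      qed
    qed
    ultimately show "Poly_Mapping.lookup (weight n c) u =
      Poly_Mapping.lookup ((\<Sum>i\<in>c ` {1..n}. Poly_Mapping.single i 1) +
       (\<Sum>i<k. Poly_Mapping.single i (block_sizes J ! i))) u"
      unfolding lookup_add lookup_weight by (simp only:)
  qed
  then show ?thesis
    using that[of c] conv c_J range sizes(1) by simp
qed

theorem theorem9:
  fixes n :: nat and J :: "nat set" and a :: "nat list" and k :: nat
  assumes "n \<ge> 1"
    and "J \<subseteq> {1..n - 1}"
    and "a = block_sizes J"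
    and "k = length a"
  shows "of_nat (card (M_perms n J)) =
    mcoeff (1 / ((\<Prod>i<k. 1 + mX i) * (1 - (\<Sum>i<k. mX i))) :: rat mfps)
      (\<Sum>i<k. Poly_Mapping.single i (a ! i))"
proof -
  let ?m = "\<Sum>i<k. Poly_Mapping.single i (a ! i)"
  obtain c where conv: "convex_fibres n c"
    and c_J: "\<And>i. 1 \<le> i \<Longrightarrow> i < n \<Longrightarrow> c i = c (Suc i) \<longleftrightarrow> i \<in> J"
    and range: "{..<k} \<subseteq> c ` {1..n}"
    and wt: "weight n c = (\<Sum>i\<in>c ` {1..n}. Poly_Mapping.single i 1) + ?m"
    by (rule block_colouring[OF assms(2), folded assms(3), folded assms(4)]) (rule that)
  \<comment> \<open>A fixed point is required in every colour and none is forbidden at the start;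
    afterwards all these colours are forbidden.\<close>
  obtain n' c' where conv': "convex_fibres n' c'"
    and wt': "(\<Sum>i\<in>c ` {1..n}. Poly_Mapping.single i 1) + weight n' c' = weight n c"
    and card: "card {\<sigma> \<in> dec_perms n c. c ` fixed_points n \<sigma> \<inter> {} = {} \<and> c ` {1..n} \<subseteq> c ` fixed_points n \<sigma>} =
      card {\<sigma> \<in> dec_perms n' c'. c' ` fixed_points n' \<sigma> \<inter> ({} \<union> c ` {1..n}) = {}}"
    using remove_fixed_colours[OF finite_imageI[OF finite_atLeastAtMost] Int_empty_right order_refl conv]
    by blast
  have m: "weight n' c' = ?m" using wt wt' by simp
  \<comment> \<open>The colours of singleton segments have disappeared with their only position.
    This is read off the weight, which involves only the variables below \<open>k\<close>.\<close>
  have range': "c' ` {1..n'} \<subseteq> {..<k}"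
  proof
    fix u assume "u \<in> c' ` {1..n'}"
    then have "{j\<in>{1..n'}. c' j = u} \<noteq> {}" by blast
    then have "Poly_Mapping.lookup ?m u \<noteq> 0"
      unfolding m[symmetric] lookup_weight by simp
    moreover have "Poly_Mapping.lookup ?m u = (if u < k then a ! u else 0)"
      unfolding lookup_sum lookup_single when_def by (subst sum.delta) auto
    ultimately show "u \<in> {..<k}" by (simp split: if_splits)
  qed
  have "c' ` fixed_points n' \<sigma> \<subseteq> {..<k}" for \<sigma>
    using range' unfolding fixed_points_def by blast
  then have "c' ` fixed_points n' \<sigma> \<inter> c ` {1..n} = {} \<longleftrightarrow> c' ` fixed_points n' \<sigma> \<inter> {..<k} = {}" for \<sigma>
    using range by blast
  moreover have M_eq: "M_perms n J = {\<sigma> \<in> dec_perms n c. c ` {1..n} \<subseteq> c ` fixed_points n \<sigma>}"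
    by (rule M_perms_eq[OF conv assms(2)]) (rule c_J)
  ultimately have M: "card (M_perms n J) =
      card {\<sigma> \<in> dec_perms n' c'. c' ` fixed_points n' \<sigma> \<inter> {..<k} = {}}"
    using card M_eq by simp
  let ?P = "\<Prod>i<k. 1 + mX i :: rat mfps" and ?Q = "1 - (\<Sum>i<k. mX i) :: rat mfps"
  have "(?P * ?Q) * inverse (?P * ?Q) = 1"
    by (rule mfps_mult_inverse[OF mfps_denominator_unit])
  \<comment> \<open>Regrouping exhibits \<open>?P * inverse (?P * ?Q)\<close> as the inverse
    \<open>B\<close> of \<open>?Q\<close>; the inverse of the whole denominator is then the series
    \<open>A\<close> with \<open>?P * A = B\<close>.\<close>
  then have "?Q * (?P * inverse (?P * ?Q)) = 1"
    by (simp only: ac_simps)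
  then have "mcoeff (inverse (?P * ?Q)) (weight n' c') =
      of_nat (card {\<sigma> \<in> dec_perms n' c'. c' ` fixed_points n' \<sigma> \<inter> {..<k} = {}})"
    by (rule mcoeff_avoid_fixed[OF finite_lessThan _ refl conv' range'])
  then show ?thesis
    unfolding M m divide_mfps_def by simp
qed

end
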